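(* For every $d \ge 1$, every $N$-vertex, $d$-regular graph $G$, and every positive integer $n$, \[ i(G,n) \le i(K_{d,d},n)^{N/(2d)}. \]
   Context: Graphs $G$ are finite, simple and undirected. For a graph $G$ and a positive integer $n$, $i(G,n)$ denotes the number of maps $f : V(G) \to \{0,1,\dots,n\}$ such that $f(u)+f(v) \le n$ for every edge $uv \in E(G)$. $K_{d,d}$ is the complete bipartite graph with $d$ vertices on each side. *)

theory Defs
  imports Complex_Main "HOL-Library.FuncSet" "Graph_Theory.Graph_Theory"
begin

text \<open>
  A finite simple undirected graph is a symmetric loop-free digraph without parallel arcs
  (locale \<open>graph\<close>): an undirected edge \<open>uv\<close> is a pair of opposite arcs, and the degree of a
  vertex in the undirected sense is its \<open>out_degree\<close>.
\<close>

definition regular :: "nat \<Rightarrow> ('a, 'b) pre_digraph \<Rightarrow> bool" where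
  "regular d G \<longleftrightarrow> (\<forall>v \<in> verts G. out_degree G v = d)"

text \<open>
  The maps are extensional (\<open>undefined\<close> outside \<open>verts G\<close>), so that each map on the
  vertex set is counted exactly once.
\<close>

definition edge_bounded_maps :: "('a, 'b) pre_digraph \<Rightarrow> nat \<Rightarrow> ('a \<Rightarrow> nat) set" where
  "edge_bounded_maps G n =
    {f \<in> verts G \<rightarrow>\<^sub>E {0..n}. \<forall>u v. u \<rightarrow>\<^bsub>G\<^esub> v \<longrightarrow> f u + f v \<le> n}"

definition i_count :: "('a, 'b) pre_digraph \<Rightarrow> nat \<Rightarrow> nat" where
  "i_count G n = card (edge_bounded_maps G n)"

text \<open>
  The library describes the complete bipartite graph by a predicate that determines it up to
  isomorphism; it is satisfiable for all part sizes.
\<close>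

lemma complete_bipartite_exists:
  "\<exists>H :: (nat + nat, (nat + nat) \<times> (nat + nat)) pre_digraph. K\<^bsub>m,n\<^esub> H"
proof -
  define U :: "(nat + nat) set" where "U = Inl ` {..<m}"
  define V :: "(nat + nat) set" where "V = Inr ` {..<n}"
  have "finite U" "finite V" "U \<inter> V = {}" "card U = m" "card V = n"
    by (auto simp: U_def V_def card_image)
  then have "K\<^bsub>m,n\<^esub> (with_proj \<lparr>pverts = U \<union> V, parcs = U \<times> V \<union> V \<times> U\<rparr>)"
    unfolding complete_bipartite_digraph_pair_def by auto
  then show ?thesis by blast
qed

end

theory Submission
  imports Defs "HOL-Analysis.Convex"
begin

text \<open>
  Write \<open>X = {0..n}\<close>. The bound is proved by passing from \<open>G\<close> to its bipartite double cover, where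
  one side can be summed out, and applying a Hoelder type inequality there.

  The first step (\<open>i_count_squared_le\<close>) is that \<open>i(G,n)\<^sup>2\<close> is at most the number of pairs \<open>(f, g)\<close> of
  maps \<open>V(G) \<rightarrow> X\<close> with \<open>f u + g v \<le> n\<close> for every arc \<open>uv\<close>, that is, the corresponding count for the
  double cover. This is where the special form of the constraint is used: if \<open>f\<close> and \<open>g\<close> are both
  edge bounded, then an edge \<open>uv\<close> with \<open>f u + g v > n\<close> has \<open>g u < f u\<close> and \<open>f v < g v\<close>, so the edges
  spoiling the pair form a bipartite graph, and exchanging \<open>f\<close> and \<open>g\<close> at the vertices with \<open>f < g\<close>
  repairs all of them. That exchange alone would forget where it took place. Since the set that it
  uses also repairs all other pairs with the same two values at each vertex, the injection
  uses one common set for all of them.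

  In the double cover, once \<open>f\<close> is chosen the values \<open>g v\<close> can be chosen independently, and the
  number of choices for \<open>g v\<close> depends only on \<open>f\<close> on the neighbourhood \<open>N(v)\<close>
  (\<open>card_cross_bounded_pairs\<close>). The count is therefore \<open>\<Sum>f. \<Prod>v. \<phi>\<^sub>v(f|N(v))\<close>, in which each vertex
  lies in exactly \<open>d\<close> of the sets \<open>N(v)\<close>. The Finner inequality (\<open>finner_inequality\<close>), a form of
  Hoelder's inequality for functions of overlapping groups of variables, bounds it by the product
  over \<open>v\<close> of the \<open>d\<close>-th roots of \<open>\<Sum>x. \<phi>\<^sub>v(x)\<^sup>d\<close>, with \<open>x\<close> ranging over the maps \<open>N(v) \<rightarrow> X\<close>. Each
  of these sums is exactly \<open>i(K\<^sub>d\<^sub>,\<^sub>d, n)\<close>, counted by choosing the values on one side first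
  (\<open>i_count_complete_bipartite\<close>), so \<open>i(G,n)\<^sup>2\<close> is at most the \<open>N\<close>-th power of the \<open>d\<close>-th root of
  \<open>i(K\<^sub>d\<^sub>,\<^sub>d, n)\<close>.
\<close>

section \<open>The inequalities of Hoelder and Finner for finite sums\<close>

lemma root_prod:
  assumes "d > 0"
  shows "root d (\<Prod>i\<in>A. f i) = (\<Prod>i\<in>A. root d (f i))"
  using assms by (induction A rule: infinite_finite_induct) (auto simp: real_root_mult)

text \<open>
  Scaling each \<open>h j\<close> to have sum 1 reduces the claim to the AM-GM inequality, applied for each
  \<open>a\<close> to the \<open>d\<close> numbers \<open>h j a\<close>.
\<close>

lemma Hoelder_sum_prod_root:
  fixes h :: "'j \<Rightarrow> 'x \<Rightarrow> real"
  assumes "finite X" and "card J > 0"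
    and nonneg: "\<And>j a. j \<in> J \<Longrightarrow> a \<in> X \<Longrightarrow> h j a \<ge> 0"
  shows "(\<Sum>a\<in>X. \<Prod>j\<in>J. root (card J) (h j a)) \<le> (\<Prod>j\<in>J. root (card J) (\<Sum>a\<in>X. h j a))"
proof -
  define d where "d = card J"
  define H where "H j = (\<Sum>a\<in>X. h j a)" for j
  have J: "finite J" "J \<noteq> {}" "d > 0"
    using assms(2) by (auto simp: d_def card_gt_0_iff)
  have H_nonneg: "H j \<ge> 0" if "j \<in> J" for j
    unfolding H_def using nonneg[OF that] by (rule sum_nonneg)
  have h_le: "h j a \<le> H j" if "j \<in> J" "a \<in> X" for j a
    unfolding H_def by (rule member_le_sum) (use assms that in auto)
  show ?thesis
  proof (cases "\<exists>j\<in>J. H j = 0")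
    case True
    then obtain j where j: "j \<in> J" "H j = 0" by blast
    have "(\<Prod>i\<in>J. root d (h i a)) = 0" if "a \<in> X" for a
    proof -
      have "h j a = 0"
        using h_le[OF j(1) that] nonneg[OF j(1) that] j(2) by simp
      then show ?thesis using J j(1) by (auto simp: prod_zero_iff)
    qed
    moreover have "(\<Prod>i\<in>J. root d (H i)) \<ge> 0"
      using H_nonneg J by (intro prod_nonneg) auto
    ultimately show ?thesis
      by (simp add: d_def[symmetric] H_def[symmetric])
  next
    case False
    then have H_pos: "H j > 0" if "j \<in> J" for j
      using H_nonneg that by (metis less_eq_real_def)
    define P where "P = (\<Prod>j\<in>J. root d (H j))"
    have "P \<ge> 0"
      unfolding P_def using H_nonneg J by (intro prod_nonneg) auto
    have AMGM: "(\<Prod>j\<in>J. root d (h j a)) \<le> P * (\<Sum>j\<in>J. h j a / H j / d)" if "a \<in> X" for a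
    proof -
      have q: "h j a / H j \<ge> 0" if "j \<in> J" for j
        using nonneg[OF that \<open>a \<in> X\<close>] H_nonneg[OF that] by simp
      have "(\<Prod>j\<in>J. root d (h j a)) = P * root d (\<Prod>j\<in>J. h j a / H j)"
        unfolding P_def root_prod[OF J(3)] prod.distrib[symmetric]
        by (rule prod.cong[OF refl]) (use H_pos in \<open>force simp: real_root_mult[symmetric]\<close>)
      also have "root d (\<Prod>j\<in>J. h j a / H j) = (\<Prod>j\<in>J. h j a / H j) powr (1 / card J)"
        using J q by (simp add: root_powr_inverse prod_nonneg d_def)
      also have "\<dots> \<le> (\<Sum>j\<in>J. h j a / H j / d)"
        unfolding d_def using J q by (intro arith_geom_mean) auto
      finally show ?thesis
        using \<open>P \<ge> 0\<close> by (simp add: mult_left_mono)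
    qed
    have "(\<Sum>a\<in>X. \<Prod>j\<in>J. root d (h j a)) \<le> (\<Sum>a\<in>X. P * (\<Sum>j\<in>J. h j a / H j / d))"
      by (rule sum_mono) (rule AMGM)
    also have "\<dots> = P * (\<Sum>j\<in>J. \<Sum>a\<in>X. h j a / H j / d)"
      by (simp add: sum_distrib_left[symmetric] sum.swap[of _ X J])
    also have "(\<Sum>j\<in>J. \<Sum>a\<in>X. h j a / H j / d) = (\<Sum>j\<in>J. 1 / d)"
    proof (rule sum.cong[OF refl])
      fix j assume "j \<in> J"
      have "(\<Sum>a\<in>X. h j a / H j / d) = H j / H j / d"
        unfolding H_def sum_divide_distrib ..
      then show "(\<Sum>a\<in>X. h j a / H j / d) = 1 / d"
        using H_pos[OF \<open>j \<in> J\<close>] by simp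
    qed
    also have "\<dots> = 1"
      using J by (simp add: d_def)
    finally show ?thesis
      by (simp add: P_def H_def d_def)
  qed
qed

lemma sum_PiE_insert:
  assumes "u \<notin> U"
  shows "(\<Sum>F\<in>insert u U \<rightarrow>\<^sub>E X. g F) = (\<Sum>a\<in>X. \<Sum>F\<in>U \<rightarrow>\<^sub>E X. g (F(u := a)))"
  unfolding PiE_insert_eq sum.cartesian_product
  by (subst sum.reindex[OF inj_combinator[OF assms]]) (simp add: case_prod_unfold)

text \<open>
  Induction on the number of variables. With the value \<open>a\<close> of one variable \<open>u\<close> fixed, the induction
  hypothesis bounds the sum over the others; exactly \<open>d\<close> of the factors in this bound depend
  on \<open>a\<close>, so that Hoelder's inequality with \<open>d\<close> functions handles the sum over \<open>a\<close>.
\<close>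

lemma finner_inequality:
  fixes \<phi> :: "'v \<Rightarrow> ('u \<Rightarrow> 'x) \<Rightarrow> real"
  assumes "finite U" and "finite V" and "finite X" and "d > 0"
    and "\<And>v. v \<in> V \<Longrightarrow> S v \<subseteq> U"
    and "\<And>u. u \<in> U \<Longrightarrow> card {v \<in> V. u \<in> S v} = d"
    and "\<And>v x. \<phi> v x \<ge> 0"
  shows "(\<Sum>F\<in>U \<rightarrow>\<^sub>E X. \<Prod>v\<in>V. \<phi> v (restrict F (S v)))
    \<le> (\<Prod>v\<in>V. root d (\<Sum>x\<in>S v \<rightarrow>\<^sub>E X. \<phi> v x ^ d))"
  using assms(1,5-7)
proof (induction U arbitrary: S \<phi> rule: finite_induct)
  case empty
  have "(\<Prod>v\<in>V. \<phi> v (\<lambda>_. undefined))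
      = (\<Prod>v\<in>V. root d (\<Sum>x\<in>S v \<rightarrow>\<^sub>E X. \<phi> v x ^ d))"
  proof (rule prod.cong[OF refl])
    fix v assume "v \<in> V"
    then have "S v = {}" using empty.prems(1) by blast
    then show "\<phi> v (\<lambda>_. undefined) = root d (\<Sum>x\<in>S v \<rightarrow>\<^sub>E X. \<phi> v x ^ d)"
      using empty.prems(3) \<open>d > 0\<close> by (simp add: real_root_power_cancel)
  qed
  then show ?case by simp
next
  case (insert u U)
  define T where "T v = S v - {u}" for v
  \<comment> \<open>The factor of \<open>v\<close> as a function of the remaining variables once \<open>u\<close> has the value \<open>a\<close>.\<close>
  define \<psi> where "\<psi> a v y = \<phi> v (if u \<in> S v then y(u := a) else y)" for a v y
  define J where "J = {v \<in> V. u \<in> S v}"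
  define R where "R v = (\<Sum>x\<in>S v \<rightarrow>\<^sub>E X. \<phi> v x ^ d)" for v
  define h where "h v a = (\<Sum>y\<in>T v \<rightarrow>\<^sub>E X. \<psi> a v y ^ d)" for v a
  have J: "card J = d" "J \<subseteq> V" "finite J"
    using insert.prems(2)[of u] \<open>finite V\<close> by (auto simp: J_def)
  have h_nonneg: "h v a \<ge> 0" for v a
    unfolding h_def \<psi>_def using insert.prems(3) by (intro sum_nonneg zero_le_power)
  have h_const: "h v a = R v" if "v \<in> V - J" for v a
    using that by (auto simp: h_def R_def T_def \<psi>_def J_def)
  have h_sum: "(\<Sum>a\<in>X. h v a) = R v" if "v \<in> J" for v
  proof -
    have "u \<in> S v" using that by (simp add: J_def)
    then have "S v = insert u (T v)" "u \<notin> T v" by (auto simp: T_def)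
    then show ?thesis
      using \<open>u \<in> S v\<close> by (simp add: R_def h_def \<psi>_def sum_PiE_insert)
  qed
  have R_nonneg: "R v \<ge> 0" for v
    unfolding R_def using insert.prems(3) by (intro sum_nonneg zero_le_power)
  have IH: "(\<Sum>F\<in>U \<rightarrow>\<^sub>E X. \<Prod>v\<in>V. \<psi> a v (restrict F (T v))) \<le> (\<Prod>v\<in>V. root d (h v a))" for a
    unfolding h_def
  proof (rule insert.IH)
    show "T v \<subseteq> U" if "v \<in> V" for v
      using insert.prems(1)[OF that] by (auto simp: T_def)
    show "card {v \<in> V. w \<in> T v} = d" if "w \<in> U" for w
    proof -
      have "{v \<in> V. w \<in> T v} = {v \<in> V. w \<in> S v}"
        using that insert.hyps by (auto simp: T_def)
      then show ?thesis using insert.prems(2)[of w] that by simp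
    qed
  qed (simp add: \<psi>_def insert.prems(3))
  have restrict_upd: "restrict (F(u := a)) (S v)
      = (if u \<in> S v then (restrict F (T v))(u := a) else restrict F (T v))" for F :: "'u \<Rightarrow> 'x" and a v
    by (auto simp: T_def restrict_def fun_eq_iff)
  have "(\<Sum>F\<in>insert u U \<rightarrow>\<^sub>E X. \<Prod>v\<in>V. \<phi> v (restrict F (S v)))
      = (\<Sum>a\<in>X. \<Sum>F\<in>U \<rightarrow>\<^sub>E X. \<Prod>v\<in>V. \<psi> a v (restrict F (T v)))"
    unfolding sum_PiE_insert[OF insert.hyps(2)] restrict_upd \<psi>_def ..
  also have "\<dots> \<le> (\<Sum>a\<in>X. \<Prod>v\<in>V. root d (h v a))"
    by (rule sum_mono) (rule IH)
  also have "\<dots> = (\<Sum>a\<in>X. (\<Prod>v\<in>V - J. root d (R v)) * (\<Prod>v\<in>J. root d (h v a)))"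
    by (simp add: prod.subset_diff[OF J(2) \<open>finite V\<close>] h_const)
  also have "\<dots> = (\<Prod>v\<in>V - J. root d (R v)) * (\<Sum>a\<in>X. \<Prod>v\<in>J. root d (h v a))"
    by (simp add: sum_distrib_left)
  also have "\<dots> \<le> (\<Prod>v\<in>V - J. root d (R v)) * (\<Prod>v\<in>J. root d (\<Sum>a\<in>X. h v a))"
    using Hoelder_sum_prod_root[of X J h] J \<open>finite X\<close> \<open>d > 0\<close> h_nonneg R_nonneg
    by (intro mult_left_mono prod_nonneg) auto
  also have "\<dots> = (\<Prod>v\<in>V. root d (R v))"
    by (simp add: prod.subset_diff[OF J(2) \<open>finite V\<close>] h_sum)
  finally show ?case unfolding R_def .
qed

section \<open>Counting maps with bounded sums across a bipartite relation\<close>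

definition cross_bounded_pairs ::
    "nat \<Rightarrow> 'a set \<Rightarrow> 'b set \<Rightarrow> ('a \<times> 'b) set \<Rightarrow> (('a \<Rightarrow> nat) \<times> ('b \<Rightarrow> nat)) set" where
  "cross_bounded_pairs n A B E =
    {(f, g). f \<in> A \<rightarrow>\<^sub>E {0..n} \<and> g \<in> B \<rightarrow>\<^sub>E {0..n} \<and>
      (\<forall>a\<in>A. \<forall>b\<in>B. (a, b) \<in> E \<longrightarrow> f a + g b \<le> n)}"

definition compatible_values :: "nat \<Rightarrow> 'a set \<Rightarrow> ('a \<Rightarrow> nat) \<Rightarrow> nat set" where
  "compatible_values n S f = {y \<in> {0..n}. \<forall>a\<in>S. f a + y \<le> n}"

lemma finite_cross_bounded_pairs:
  assumes "finite A" "finite B"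
  shows "finite (cross_bounded_pairs n A B E)"
proof (rule finite_subset)
  show "cross_bounded_pairs n A B E \<subseteq> (A \<rightarrow>\<^sub>E {0..n}) \<times> (B \<rightarrow>\<^sub>E {0..n})"
    by (auto simp: cross_bounded_pairs_def)
  show "finite ((A \<rightarrow>\<^sub>E {0..n}) \<times> (B \<rightarrow>\<^sub>E {0..n}))"
    using assms by (intro finite_cartesian_product finite_PiE) auto
qed

lemma card_cross_bounded_pairs:
  assumes "finite A" "finite B"
  shows "card (cross_bounded_pairs n A B E)
    = (\<Sum>f\<in>A \<rightarrow>\<^sub>E {0..n}. \<Prod>b\<in>B. card (compatible_values n {a \<in> A. (a, b) \<in> E} f))"
proof -
  have "cross_bounded_pairs n A B E
      = (SIGMA f : A \<rightarrow>\<^sub>E {0..n}. \<Pi>\<^sub>E b\<in>B. compatible_values n {a \<in> A. (a, b) \<in> E} f)"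
    unfolding set_eq_iff split_paired_All cross_bounded_pairs_def compatible_values_def PiE_iff
      mem_Sigma_iff mem_Collect_eq case_prod_conv by blast
  moreover have "finite (A \<rightarrow>\<^sub>E {0..n})"
    using assms by (intro finite_PiE) auto
  moreover have "finite (\<Pi>\<^sub>E b\<in>B. compatible_values n {a \<in> A. (a, b) \<in> E} f)" for f
    using assms by (intro finite_PiE) (auto simp: compatible_values_def)
  ultimately show ?thesis
    using assms by (simp add: card_SigmaI card_PiE)
qed

lemma compatible_values_restrict [simp]:
  "compatible_values n S (restrict f S) = compatible_values n S f"
  by (auto simp: compatible_values_def)

text \<open>
  Transporting maps along a bijection from \<open>S\<close> to \<open>T\<close> lets one side of a complete bipartite graph
  stand in for every neighbourhood of the same size in a regular graph.
\<close>

lemma sum_compatible_values_cong_card: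
  assumes "finite S" "finite T" "card S = card T"
  shows "(\<Sum>f\<in>S \<rightarrow>\<^sub>E {0..n}. card (compatible_values n S f) ^ d)
    = (\<Sum>f\<in>T \<rightarrow>\<^sub>E {0..n}. card (compatible_values n T f) ^ d)"
proof -
  obtain b where b: "bij_betw b S T"
    using assms finite_same_card_bij by blast
  define c where "c = inv_into S b"
  have c: "bij_betw c T S" "\<And>s. s \<in> S \<Longrightarrow> c (b s) = s" "\<And>t. t \<in> T \<Longrightarrow> b (c t) = t"
    using b by (auto simp: c_def bij_betw_inv_into bij_betw_inv_into_left bij_betw_inv_into_right)
  have bS: "b s \<in> T" if "s \<in> S" for s using b that by (auto dest: bij_betwE)
  have cT: "c t \<in> S" if "t \<in> T" for t using c(1) that by (auto dest: bij_betwE)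
  show ?thesis
  proof (rule sum.reindex_bij_witness
      [where i = "\<lambda>g. restrict (g \<circ> b) S" and j = "\<lambda>f. restrict (f \<circ> c) T"])
    fix f assume f: "f \<in> S \<rightarrow>\<^sub>E {0..n}"
    show "restrict (restrict (f \<circ> c) T \<circ> b) S = f"
      using c(2) bS PiE_arb[OF f] by (auto simp: fun_eq_iff)
    show "restrict (f \<circ> c) T \<in> T \<rightarrow>\<^sub>E {0..n}"
      using f cT by (auto simp: PiE_iff)
    have "c ` T = S"
      using c(1) by (rule bij_betw_imp_surj_on)
    then have "compatible_values n T (f \<circ> c) = compatible_values n S f"
      by (auto simp: compatible_values_def)
    then show "card (compatible_values n T (restrict (f \<circ> c) T)) ^ d
        = card (compatible_values n S f) ^ d"
      by simp
  next
    fix g assume g: "g \<in> T \<rightarrow>\<^sub>E {0..n}"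
    show "restrict (restrict (g \<circ> b) S \<circ> c) T = g"
      using c(3) cT PiE_arb[OF g] by (auto simp: fun_eq_iff)
    show "restrict (g \<circ> b) S \<in> S \<rightarrow>\<^sub>E {0..n}"
      using g bS by (auto simp: PiE_iff)
  qed
qed

lemma i_count_complete_bipartite:
  assumes "K\<^bsub>p,q\<^esub> K" and "finite S" and "card S = p"
  shows "i_count K n = (\<Sum>f\<in>S \<rightarrow>\<^sub>E {0..n}. card (compatible_values n S f) ^ q)"
proof -
  obtain A B where AB: "verts K = A \<union> B" "A \<inter> B = {}" "card A = p" "card B = q"
      "arcs_ends K = A \<times> B \<union> B \<times> A" and "graph K"
    using assms(1) unfolding complete_bipartite_digraph_def by blast
  interpret graph K by fact
  have fin: "finite A" "finite B"
    using finite_verts AB(1) by auto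
  define glue where "glue = (\<lambda>(f, g) x. if x \<in> A then f x else g x :: nat)"
  have "bij_betw (\<lambda>f. (restrict f A, restrict f B)) (edge_bounded_maps K n)
      (cross_bounded_pairs n A B UNIV)"
  proof (rule bij_betw_byWitness[where f' = glue])
    show "\<forall>f\<in>edge_bounded_maps K n. glue (restrict f A, restrict f B) = f"
    proof
      fix f assume "f \<in> edge_bounded_maps K n"
      then have "f \<in> extensional (A \<union> B)"
        by (simp add: edge_bounded_maps_def AB PiE_def)
      then show "glue (restrict f A, restrict f B) = f"
        by (auto simp: glue_def fun_eq_iff extensional_def)
    qed
    show "\<forall>p\<in>cross_bounded_pairs n A B UNIV. (restrict (glue p) A, restrict (glue p) B) = p"
    proof
      fix p assume "p \<in> cross_bounded_pairs n A B UNIV"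
      then obtain f g where "p = (f, g)" "f \<in> extensional A" "g \<in> extensional B"
        by (auto simp: cross_bounded_pairs_def PiE_def)
      then show "(restrict (glue p) A, restrict (glue p) B) = p"
        using AB(2) by (auto simp: glue_def fun_eq_iff extensional_def restrict_def)
    qed
    show "(\<lambda>f. (restrict f A, restrict f B)) ` edge_bounded_maps K n
        \<subseteq> cross_bounded_pairs n A B UNIV"
    proof (rule image_subsetI)
      fix f assume "f \<in> edge_bounded_maps K n"
      then have "\<forall>x\<in>A \<union> B. f x \<le> n" "\<forall>a\<in>A. \<forall>b\<in>B. f a + f b \<le> n"
        by (simp_all add: edge_bounded_maps_def AB PiE_iff)
      then show "(restrict f A, restrict f B) \<in> cross_bounded_pairs n A B UNIV"
        by (simp add: cross_bounded_pairs_def PiE_iff)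
    qed
    show "glue ` cross_bounded_pairs n A B UNIV \<subseteq> edge_bounded_maps K n"
    proof (rule image_subsetI)
      fix p assume "p \<in> cross_bounded_pairs n A B UNIV"
      then obtain f g where p: "p = (f, g)" "f \<in> A \<rightarrow>\<^sub>E {0..n}" "g \<in> B \<rightarrow>\<^sub>E {0..n}"
          and le: "\<And>a b. a \<in> A \<Longrightarrow> b \<in> B \<Longrightarrow> f a + g b \<le> n"
        by (auto simp: cross_bounded_pairs_def)
      have glue_A: "glue p x = f x" if "x \<in> A" for x
        using that by (simp add: glue_def p(1))
      have glue_B: "glue p x = g x" if "x \<in> B" for x
        using that AB(2) by (auto simp: glue_def p(1))
      have "glue p \<in> A \<union> B \<rightarrow>\<^sub>E {0..n}"
      proof (rule PiE_I)
        show "glue p x \<in> {0..n}" if "x \<in> A \<union> B" for x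
          using that PiE_mem[OF p(2), of x] PiE_mem[OF p(3), of x] glue_A glue_B by auto
        show "glue p x = undefined" if "x \<notin> A \<union> B" for x
          using that PiE_arb[OF p(3), of x] by (simp add: glue_def p(1))
      qed
      moreover have "glue p u + glue p v \<le> n" if "u \<rightarrow>\<^bsub>K\<^esub> v" for u v
        using that le glue_A glue_B unfolding AB(5) by (auto simp: add.commute)
      ultimately show "glue p \<in> edge_bounded_maps K n"
        by (simp add: edge_bounded_maps_def AB(1))
    qed
  qed
  then have "i_count K n = card (cross_bounded_pairs n A B UNIV)"
    unfolding i_count_def by (rule bij_betw_same_card)
  also have "\<dots> = (\<Sum>f\<in>A \<rightarrow>\<^sub>E {0..n}. card (compatible_values n A f) ^ q)"
    using fin AB(4) by (simp add: card_cross_bounded_pairs)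
  also have "\<dots> = (\<Sum>f\<in>S \<rightarrow>\<^sub>E {0..n}. card (compatible_values n S f) ^ q)"
    using fin assms AB(3) by (intro sum_compatible_values_cong_card) auto
  finally show ?thesis .
qed

section \<open>Passing to the bipartite double cover\<close>

definition swap_on :: "'a set \<Rightarrow> ('a \<Rightarrow> 'b) \<times> ('a \<Rightarrow> 'b) \<Rightarrow> ('a \<Rightarrow> 'b) \<times> ('a \<Rightarrow> 'b)" where
  "swap_on W p =
    (\<lambda>v. if v \<in> W then snd p v else fst p v, \<lambda>v. if v \<in> W then fst p v else snd p v)"

definition value_sets :: "('a \<Rightarrow> 'b) \<times> ('a \<Rightarrow> 'b) \<Rightarrow> 'a \<Rightarrow> 'b set" where
  "value_sets p v = {fst p v, snd p v}"

lemma swap_on_swap_on [simp]: "swap_on W (swap_on W p) = p"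
  by (auto simp: swap_on_def prod_eq_iff)

lemma value_sets_swap_on [simp]: "value_sets (swap_on W p) = value_sets p"
  by (auto simp: swap_on_def value_sets_def fun_eq_iff)

text \<open>
  The set where a reference pair \<open>(f\<^sub>0, g\<^sub>0)\<close> has \<open>f\<^sub>0 < g\<^sub>0\<close> serves every pair \<open>(f, g)\<close> that takes the
  same two values at each vertex. On an edge \<open>uv\<close> with exactly one end swapped, the new cross sum
  is \<open>f u + f v\<close> or \<open>g u + g v\<close>. If the ends are both swapped or both not swapped, then one
  of \<open>f\<^sub>0\<close>, \<open>g\<^sub>0\<close> takes the larger of the two values at both ends, so even the sum of the maxima is
  at most \<open>n\<close>.
\<close>

lemma swap_on_cross_bounded:
  fixes f\<^sub>0 g\<^sub>0 :: "'a \<Rightarrow> nat"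
  assumes "p \<in> edge_bounded_maps G n \<times> edge_bounded_maps G n"
    and "(f\<^sub>0, g\<^sub>0) \<in> edge_bounded_maps G n \<times> edge_bounded_maps G n"
    and same_values: "value_sets (f\<^sub>0, g\<^sub>0) = value_sets p"
  shows "swap_on {v. f\<^sub>0 v < g\<^sub>0 v} p \<in> cross_bounded_pairs n (verts G) (verts G) (arcs_ends G)"
proof -
  obtain f g where p: "p = (f, g)" by (cases p)
  define W where "W = {v. f\<^sub>0 v < g\<^sub>0 v}"
  have PiE: "f \<in> verts G \<rightarrow>\<^sub>E {0..n}" "g \<in> verts G \<rightarrow>\<^sub>E {0..n}"
    using assms(1) by (auto simp: p edge_bounded_maps_def)
  have "(if u \<in> W then g u else f u) + (if v \<in> W then f v else g v) \<le> n"
    if "u \<rightarrow>\<^bsub>G\<^esub> v" for u v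
  proof -
    have "f u + f v \<le> n" "g u + g v \<le> n" "f\<^sub>0 u + f\<^sub>0 v \<le> n" "g\<^sub>0 u + g\<^sub>0 v \<le> n"
      using assms(1,2) that by (auto simp: p edge_bounded_maps_def)
    moreover have "f\<^sub>0 w = f w \<and> g\<^sub>0 w = g w \<or> f\<^sub>0 w = g w \<and> g\<^sub>0 w = f w" for w
      using fun_cong[OF same_values, of w] by (auto simp: p value_sets_def doubleton_eq_iff)
    \<comment> \<open>Now a case distinction at \<open>u\<close> and at \<open>v\<close> leaves linear arithmetic.\<close>
    from this[of u] this[of v] calculation show ?thesis
      by (auto simp: W_def)
  qed
  moreover have "(\<lambda>v. if v \<in> W then g v else f v) \<in> verts G \<rightarrow>\<^sub>E {0..n}"
      "(\<lambda>v. if v \<in> W then f v else g v) \<in> verts G \<rightarrow>\<^sub>E {0..n}"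
    using PiE by (auto simp: PiE_iff extensional_def)
  ultimately show ?thesis
    unfolding W_def[symmetric] cross_bounded_pairs_def swap_on_def p fst_conv snd_conv by blast
qed

text \<open>
  Choosing one reference pair for each value of \<open>value_sets\<close> makes the repair injective: swapping
  preserves \<open>value_sets\<close>, hence the set that was swapped can be read off from the result.
\<close>

lemma i_count_squared_le:
  assumes "finite (verts G)"
  shows "(i_count G n)\<^sup>2 \<le> card (cross_bounded_pairs n (verts G) (verts G) (arcs_ends G))"
proof -
  define M where "M = edge_bounded_maps G n \<times> edge_bounded_maps G n"
  define ref where "ref k = (SOME p. p \<in> M \<and> value_sets p = k)" for k
  define W where "W k = {v. fst (ref k) v < snd (ref k) v}" for k
  define \<Phi> where "\<Phi> p = swap_on (W (value_sets p)) p" for p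
  have "inj_on \<Phi> M"
  proof (rule inj_onI)
    fix p q assume eq: "\<Phi> p = \<Phi> q"
    then have "value_sets p = value_sets q"
      unfolding \<Phi>_def by (metis value_sets_swap_on)
    with eq show "p = q"
      unfolding \<Phi>_def by (metis swap_on_swap_on)
  qed
  moreover have "\<Phi> ` M \<subseteq> cross_bounded_pairs n (verts G) (verts G) (arcs_ends G)"
  proof
    fix q assume "q \<in> \<Phi> ` M"
    then obtain p where p: "p \<in> M" "q = \<Phi> p" by blast
    have "ref (value_sets p) \<in> M \<and> value_sets (ref (value_sets p)) = value_sets p"
      unfolding ref_def by (rule someI[of _ p]) (use p in simp)
    then show "q \<in> cross_bounded_pairs n (verts G) (verts G) (arcs_ends G)"
      using swap_on_cross_bounded[of p G n "fst (ref (value_sets p))" "snd (ref (value_sets p))"] p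
      by (simp add: \<Phi>_def W_def M_def)
  qed
  ultimately have "card M \<le> card (cross_bounded_pairs n (verts G) (verts G) (arcs_ends G))"
    using assms by (intro card_inj_on_le finite_cross_bounded_pairs)
  then show ?thesis
    by (simp add: M_def i_count_def card_cartesian_product power2_eq_square)
qed

section \<open>Regular graphs\<close>

lemma (in nomulti_digraph) card_out_neighbours:
  "card {v. u \<rightarrow> v} = out_degree G u"
proof -
  have "bij_betw (head G) (out_arcs G u) {v. u \<rightarrow> v}"
    unfolding bij_betw_def
  proof
    show "inj_on (head G) (out_arcs G u)"
      by (rule inj_onI) (auto simp: arc_to_ends_def intro: no_multi_arcs)
    show "head G ` out_arcs G u = {v. u \<rightarrow> v}"
      by (auto simp: arcs_ends_conv)
  qed
  then show ?thesis
    by (simp add: out_degree_def bij_betw_same_card)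
qed

lemma i_count_pos:
  assumes "wf_digraph G" and "finite (verts G)"
  shows "i_count G n > 0"
proof -
  interpret wf_digraph G by fact
  have "(\<lambda>v\<in>verts G. 0) \<in> edge_bounded_maps G n"
    by (auto simp: edge_bounded_maps_def arcs_ends_conv)
  moreover have "finite (edge_bounded_maps G n)"
    by (rule finite_subset[of _ "verts G \<rightarrow>\<^sub>E {0..n}"])
      (auto simp: edge_bounded_maps_def assms(2) intro: finite_PiE)
  ultimately show ?thesis
    by (auto simp: i_count_def card_gt_0_iff)
qed

theorem theorem2p9:
  fixes G :: "('a, 'b) pre_digraph"
    and K :: "('c, 'e) pre_digraph"
    and d N n :: nat
  assumes "d \<ge> 1"
    and "graph G"
    and "card (verts G) = N"
    and "regular d G"
    and "n \<ge> 1"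
    and "K\<^bsub>d,d\<^esub> K"
  shows "real (i_count G n) \<le> real (i_count K n) powr (real N / (2 * real d))"
proof -
  interpret G: graph G by fact
  define V where "V = verts G"
  define nb where "nb v = {u \<in> V. u \<rightarrow>\<^bsub>G\<^esub> v}" for v
  define \<phi> :: "'a \<Rightarrow> ('a \<Rightarrow> nat) \<Rightarrow> real" where "\<phi> v f = card (compatible_values n (nb v) f)" for v f
  have sym: "u \<rightarrow>\<^bsub>G\<^esub> v \<longleftrightarrow> v \<rightarrow>\<^bsub>G\<^esub> u" for u v
    using arcs_ends_symmetric[OF G.sym_arcs] by blast
  have in_V: "u \<in> V" if "u \<rightarrow>\<^bsub>G\<^esub> v" for u v
    using that by (auto simp: V_def arcs_ends_conv)
  have nb_eq: "nb v = {u. v \<rightarrow>\<^bsub>G\<^esub> u}" for v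
    using in_V sym by (auto simp: nb_def)
  have card_nb: "card (nb v) = d" if "v \<in> V" for v
    using that \<open>regular d G\<close> by (simp add: nb_eq G.card_out_neighbours regular_def V_def)
  have "finite V" by (simp add: V_def)
  have fin_nb: "finite (nb v)" for v
    using \<open>finite V\<close> by (simp add: nb_def)
  have local_count: "(\<Sum>x\<in>nb v \<rightarrow>\<^sub>E {0..n}. \<phi> v x ^ d) = real (i_count K n)" if "v \<in> V" for v
    using i_count_complete_bipartite[OF \<open>K\<^bsub>d,d\<^esub> K\<close> fin_nb card_nb[OF that], of n]
    by (simp add: \<phi>_def)
  have "real ((i_count G n)\<^sup>2) \<le> real (card (cross_bounded_pairs n V V (arcs_ends G)))"
    unfolding V_def by (intro of_nat_mono i_count_squared_le) simp
  also have "\<dots> = (\<Sum>f\<in>V \<rightarrow>\<^sub>E {0..n}. \<Prod>v\<in>V. \<phi> v (restrict f (nb v)))"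
    using \<open>finite V\<close> by (simp add: card_cross_bounded_pairs \<phi>_def nb_def[symmetric])
  also have "\<dots> \<le> (\<Prod>v\<in>V. root d (\<Sum>x\<in>nb v \<rightarrow>\<^sub>E {0..n}. \<phi> v x ^ d))"
  proof (rule finner_inequality)
    show "card {v \<in> V. u \<in> nb v} = d" if "u \<in> V" for u
    proof -
      have "{v \<in> V. u \<in> nb v} = nb u"
        using that sym by (auto simp: nb_def)
      then show ?thesis using card_nb[OF that] by simp
    qed
  qed (use \<open>finite V\<close> \<open>d \<ge> 1\<close> in \<open>auto simp: nb_def \<phi>_def\<close>)
  also have "\<dots> = root d (i_count K n) ^ N"
    using \<open>card (verts G) = N\<close> by (simp add: local_count V_def[symmetric])
  also have "\<dots> = (real (i_count K n) powr (real N / (2 * real d)))\<^sup>2"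
  proof -
    have "graph K"
      using \<open>K\<^bsub>d,d\<^esub> K\<close> by (simp add: complete_bipartite_digraph_def)
    then interpret K: graph K .
    \<comment> \<open>If \<open>N = 0\<close>, the exponent is 0, and the power is 1 only for a nonzero base.\<close>
    have "i_count K n > 0"
      by (rule i_count_pos) (use K.wf_digraph in auto)
    then show ?thesis
      using \<open>d \<ge> 1\<close> by (simp add: root_powr_inverse powr_power)
  qed
  finally show ?thesis
    unfolding of_nat_power by (rule power2_le_imp_le) simp
qed

end
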